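(* Let $\mathcal A$ be the automaton with set of states $\{a,b,c,d\}$ over the alphabet $X=\{0,1\}$ given by the wreath recursion $a=(b,d)\sigma$, $b=(d,b)\sigma$, $c=(a,c)$, $d=(c,a)$. Then $\mathcal A$ is a (4-state, 2-letter) bireversible automaton, and the group $\mathcal G=\langle a,b,c,d\rangle$ generated by $\mathcal A$ is isomorphic to the rank $2$ lamplighter group $\mathcal L_{2,2}\cong(\mathbb Z_2^2)\wr\mathbb Z$.
   Context: $\mathbb Z_2=\mathbb Z/2\mathbb Z$. The lamplighter group $\mathcal L_{n,d}=(\mathbb Z_d^n)\wr\mathbb Z$ is the restricted wreath product $\left(\bigoplus_{\mathbb Z}\mathbb Z_d^n\right)\rtimes\mathbb Z$, where $\mathbb Z$ acts by shifting the index. A (finite Mealy) automaton is a tuple $(Q,X,\pi,\lambda)$ with $Q$ a finite set of states, $X$ a finite alphabet, $\pi\colon Q\times X\to Q$ (transition function), $\lambda\colon Q\times X\to X$ (output function). It is invertible if for each $q\in Q$ the map $\lambda_q\colon x\mapsto\lambda(q,x)$ is a permutation of $X$. If it is invertible, each state $q$ induces an automorphism of the rooted tree $X^*$ of finite words (also denoted $q$), defined recursively by $q(\varnothing)=\varnothing$ and $q(xv)=\lambda(q,x)\,\big(\pi(q,x)\big)(v)$ for $x\in X$, $v\in X^*$. The group generated by the automaton is the subgroup of $\mathrm{Aut}(X^* )$ generated by the automorphisms induced by all its states. Products are composed left to right: $gh(y)=h(g(y))$. Wreath recursion notation for $X=\{0,1\}$: $q=(q_0,q_1)\rho$ with $\rho$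 a permutation of $\{0,1\}$ means $\pi(q,0)=q_0$, $\pi(q,1)=q_1$, $\lambda(q,x)=\rho(x)$; $\sigma=(01)$ is the transposition and $\rho$ is omitted when trivial. Thus $a,b$ swap the first letter, $c,d$ fix it, and the states at $0$ and $1$ are those listed. The inverse of an invertible automaton $\mathcal A=(Q,X,\pi,\lambda)$ is the automaton $\mathcal A^{-1}=(Q^{-1},X,\tilde\pi,\tilde\lambda)$, where $Q^{-1}=\{q^{-1}:q\in Q\}$ is a set of formal symbols in bijection with $Q$, $\tilde\pi(q^{-1},x)=\pi(q,\lambda_q^{-1}(x))^{-1}$ and $\tilde\lambda(q^{-1},x)=\lambda_q^{-1}(x)$. The dual of a finite automaton $\mathcal A=(Q,X,\pi,\lambda)$ is the automaton $\partial\mathcal A=(X,Q,\hat\lambda,\hat\pi)$ with set of states $X$, alphabet $Q$, transition function $\hat\lambda(x,q)=\lambda(q,x)$ and output function $\hat\pi(x,q)=\pi(q,x)$. An automaton is reversible if its dual is invertible; it is bireversible if it is invertible and both $\mathcal A$ and $\mathcal A^{-1}$ are reversible. *)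

theory Defs
  imports "HOL-Algebra.Bij" "HOL-Algebra.Product_Groups" "HOL-Combinatorics.Transposition"
begin

section \<open>Mealy automata\<close>

record ('q, 'x) mealy =
  states :: "'q set"
  alphabet :: "'x set"
  transition :: "'q \<Rightarrow> 'x \<Rightarrow> 'q"
  out_letter :: "'q \<Rightarrow> 'x \<Rightarrow> 'x"

definition automaton :: "('q, 'x) mealy \<Rightarrow> bool" where
  "automaton A \<longleftrightarrow> finite (states A) \<and> finite (alphabet A) \<and>
     (\<forall>q\<in>states A. \<forall>x\<in>alphabet A. transition A q x \<in> states A \<and> out_letter A q x \<in> alphabet A)"

definition invertible :: "('q, 'x) mealy \<Rightarrow> bool" where
  "invertible A \<longleftrightarrow> automaton A \<and> (\<forall>q\<in>states A. bij_betw (out_letter A q) (alphabet A) (alphabet A))"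

datatype 'q formal_inverse = Inv (uninv: 'q)

definition inverse_automaton :: "('q, 'x) mealy \<Rightarrow> ('q formal_inverse, 'x) mealy" where
  "inverse_automaton A =
    \<lparr>states = Inv ` states A,
     alphabet = alphabet A,
     transition = (\<lambda>p x. Inv (transition A (uninv p) (inv_into (alphabet A) (out_letter A (uninv p)) x))),
     out_letter = (\<lambda>p x. inv_into (alphabet A) (out_letter A (uninv p)) x)\<rparr>"

definition dual_automaton :: "('q, 'x) mealy \<Rightarrow> ('x, 'q) mealy" where
  "dual_automaton A =
    \<lparr>states = alphabet A,
     alphabet = states A,
     transition = (\<lambda>x q. out_letter A q x),
     out_letter = (\<lambda>x q. transition A q x)\<rparr>"

definition reversible :: "('q, 'x) mealy \<Rightarrow> bool" where
  "reversible A \<longleftrightarrow> automaton A \<and> invertible (dual_automaton A)"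

definition bireversible :: "('q, 'x) mealy \<Rightarrow> bool" where
  "bireversible A \<longleftrightarrow> invertible A \<and> reversible A \<and> reversible (inverse_automaton A)"

section \<open>Automorphisms of the rooted tree and automaton groups\<close>

definition tree_adjacent :: "'x set \<Rightarrow> 'x list \<Rightarrow> 'x list \<Rightarrow> bool" where
  "tree_adjacent X u v \<longleftrightarrow> (\<exists>x\<in>X. v = u @ [x] \<or> u = v @ [x])"

text \<open>The vertices are \<open>lists X\<close>, the root is the empty word, and automorphisms are represented by
  functions that are \<open>undefined\<close> outside \<open>lists X\<close>. Since products are composed left to right,
  \<open>g \<otimes> h\<close> is \<open>h \<circ> g\<close>; in contrast, \<open>BijGroup\<close> composes right to left.\<close>

definition tree_aut :: "'x set \<Rightarrow> ('x list \<Rightarrow> 'x list) monoid" where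
  "tree_aut X =
    \<lparr>carrier = {f \<in> Bij (lists X). f [] = [] \<and>
        (\<forall>u\<in>lists X. \<forall>v\<in>lists X. tree_adjacent X (f u) (f v) \<longleftrightarrow> tree_adjacent X u v)},
     monoid.mult = (\<lambda>g h. compose (lists X) h g),
     one = (\<lambda>w\<in>lists X. w)\<rparr>"

primrec act :: "('q, 'x) mealy \<Rightarrow> 'q \<Rightarrow> 'x list \<Rightarrow> 'x list" where
  "act A q [] = []"
| "act A q (x # v) = out_letter A q x # act A (transition A q x) v"

definition state_aut :: "('q, 'x) mealy \<Rightarrow> 'q \<Rightarrow> 'x list \<Rightarrow> 'x list" where
  "state_aut A q = (\<lambda>w\<in>lists (alphabet A). act A q w)"

definition automaton_group :: "('q, 'x) mealy \<Rightarrow> ('x list \<Rightarrow> 'x list) monoid" where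
  "automaton_group A =
     (tree_aut (alphabet A))
       \<lparr>carrier := generate (tree_aut (alphabet A)) (state_aut A ` states A)\<rparr>"

section \<open>Lamplighter groups\<close>

definition semidirect_product ::
  "'a monoid \<Rightarrow> 'b monoid \<Rightarrow> ('b \<Rightarrow> 'a \<Rightarrow> 'a) \<Rightarrow> ('a \<times> 'b) monoid" where
  "semidirect_product N H \<phi> =
    \<lparr>carrier = carrier N \<times> carrier H,
     monoid.mult = (\<lambda>(f, k) (g, l). (f \<otimes>\<^bsub>N\<^esub> \<phi> k g, k \<otimes>\<^bsub>H\<^esub> l)),
     one = (\<one>\<^bsub>N\<^esub>, \<one>\<^bsub>H\<^esub>)\<rparr>"

definition restricted_wreath_int :: "'a monoid \<Rightarrow> ((int \<Rightarrow> 'a) \<times> int) monoid" where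
  "restricted_wreath_int G =
     semidirect_product (sum_group UNIV (\<lambda>_::int. G)) integer_group (\<lambda>k f i. f (i - k))"

definition lamplighter :: "nat \<Rightarrow> nat \<Rightarrow> ((int \<Rightarrow> nat \<Rightarrow> int) \<times> int) monoid" where
  "lamplighter n d =
     restricted_wreath_int (product_group {..<n} (\<lambda>_. integer_mod_group d))"

section \<open>The 4-state automaton\<close>

datatype state = a | b | c | d

text \<open>\<open>wreath q\<close> is \<open>((q\<^sub>0, q\<^sub>1), \<rho>)\<close> for the wreath recursion \<open>q = (q\<^sub>0, q\<^sub>1)\<rho>\<close>.\<close>

primrec wreath :: "state \<Rightarrow> (state \<times> state) \<times> (nat \<Rightarrow> nat)" where
  "wreath a = ((b, d), Transposition.transpose 0 1)"
| "wreath b = ((d, b), Transposition.transpose 0 1)"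
| "wreath c = ((a, c), id)"
| "wreath d = ((c, a), id)"

definition \<A> :: "(state, nat) mealy" where
  "\<A> =
    \<lparr>states = {a, b, c, d},
     alphabet = {0, 1},
     transition = (\<lambda>q x. if x = 0 then fst (fst (wreath q)) else snd (fst (wreath q))),
     out_letter = (\<lambda>q. snd (wreath q))\<rparr>"

hide_const (open) a b c d

end

theory Submission
  imports Defs "HOL-Computational_Algebra.Polynomial_FPS" "HOL-Library.Z2" "HOL-Library.Groups_Big_Fun"
begin

text \<open>
  The four states act on words by affine maps with a common linear part. Code the letter \<open>0\<close> as the
  bit \<open>1\<close> and the letter \<open>1\<close> as the bit \<open>0\<close>, so that an infinite word becomes a power series
  \<open>F\<close> in \<open>t\<close> over the field with two elements, and a finite word a truncated one. Code the states
  as pairs of bits \<open>(s, r)\<close>: \<open>a = (1, 0)\<close>, \<open>b = (1, 1)\<close>, \<open>c = (0, 0)\<close>, \<open>d = (0, 1)\<close>. In these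
  coordinates the automaton is linear: reading the bit \<open>x\<close> in the state \<open>(s, r)\<close>, it writes \<open>x + s\<close>
  and moves to the state \<open>(r + x, s)\<close>. Solving this recursion shows that the state \<open>(s, r)\<close> acts as
  \<open>F \<mapsto> \<alpha> F + u (s + r t)\<close> with \<open>u = 1 / (1 + t)\<^sup>2\<close> and \<open>\<alpha> = 1 + t u = (1 + t + t\<^sup>2) / (1 + t)\<^sup>2\<close>
  (\<open>act_affine\<close>). In particular \<open>c\<close> is multiplication by \<open>\<alpha>\<close>.

  The shift of the lamplighter group should therefore act as multiplication by \<open>\<alpha>\<close>, and the lamps as
  translations. A configuration \<open>f\<close> with lamp values \<open>(s\<^sub>i, r\<^sub>i)\<close> gives the series
  \<open>E f = \<Sum>\<^sub>i u (s\<^sub>i + r\<^sub>i t) \<alpha>\<^bsup>-i\<^esup>\<close>, and \<open>(f, k)\<close> is sent to the map \<open>F \<mapsto> \<alpha>\<^sup>k (F + E f)\<close>. Since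
  products in the tree group are composed from left to right, this is a homomorphism
  (\<open>group_hom_lamplighter_aut\<close>).

  It is injective because \<open>1\<close> and \<open>t\<close> are linearly independent over the Laurent polynomials in
  \<open>\<alpha>\<close>, which also makes \<open>\<alpha>\<close> transcendental (\<open>alpha_independent\<close>). The reason is ramification:
  \<open>\<alpha>\<close> has a double pole at \<open>t = 1\<close>, so a relation would force \<open>(1 + t)\<^sup>2\<close> to divide a nonzero
  polynomial of degree at most one.

  Its image is the automaton group because the state with lamp value \<open>x\<close> is the image of the
  element that puts \<open>x\<close> at position \<open>1\<close> and then shifts by one, and the four states realise all
  four lamp values. Such elements generate any restricted wreath product with the integers
  (\<open>restricted_wreath_int_generated\<close>).
\<close>

section \<open>Semidirect products and restricted wreath products with the integers\<close>

lemma group_semidirect_product: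
  assumes N: "group N" and H: "group H"
    and hom: "\<And>k. k \<in> carrier H \<Longrightarrow> \<phi> k \<in> hom N N"
    and one: "\<And>f. f \<in> carrier N \<Longrightarrow> \<phi> \<one>\<^bsub>H\<^esub> f = f"
    and comp: "\<And>k l f. k \<in> carrier H \<Longrightarrow> l \<in> carrier H \<Longrightarrow> f \<in> carrier N \<Longrightarrow>
                 \<phi> (k \<otimes>\<^bsub>H\<^esub> l) f = \<phi> k (\<phi> l f)"
  shows "group (semidirect_product N H \<phi>)"
proof -
  interpret N: group N by (rule N)
  interpret H: group H by (rule H)
  have clo: "\<phi> k f \<in> carrier N" if "k \<in> carrier H" "f \<in> carrier N" for k f
    using hom[OF that(1)] that(2) by (auto simp: hom_def)
  have mul: "\<phi> k (f \<otimes>\<^bsub>N\<^esub> g) = \<phi> k f \<otimes>\<^bsub>N\<^esub> \<phi> k g"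
    if "k \<in> carrier H" "f \<in> carrier N" "g \<in> carrier N" for k f g
    using hom[OF that(1)] that(2,3) by (auto simp: hom_def)
  show ?thesis
  proof (rule groupI)
    fix x y z assume "x \<in> carrier (semidirect_product N H \<phi>)" "y \<in> carrier (semidirect_product N H \<phi>)"
      "z \<in> carrier (semidirect_product N H \<phi>)"
    then show "x \<otimes>\<^bsub>semidirect_product N H \<phi>\<^esub> y \<otimes>\<^bsub>semidirect_product N H \<phi>\<^esub> z =
               x \<otimes>\<^bsub>semidirect_product N H \<phi>\<^esub> (y \<otimes>\<^bsub>semidirect_product N H \<phi>\<^esub> z)"
      by (auto simp: semidirect_product_def clo mul comp N.m_assoc H.m_assoc)
  next
    fix x assume "x \<in> carrier (semidirect_product N H \<phi>)"
    then obtain f k where x: "x = (f, k)" and f: "f \<in> carrier N" and k: "k \<in> carrier H"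
      by (auto simp: semidirect_product_def)
    have "\<phi> (inv\<^bsub>H\<^esub> k) (inv\<^bsub>N\<^esub> f) \<otimes>\<^bsub>N\<^esub> \<phi> (inv\<^bsub>H\<^esub> k) f = \<phi> (inv\<^bsub>H\<^esub> k) \<one>\<^bsub>N\<^esub>"
      using f k by (simp flip: mul)
    also have "\<dots> = \<one>\<^bsub>N\<^esub>"
      using hom_one[OF hom N N] k by simp
    finally show "\<exists>y\<in>carrier (semidirect_product N H \<phi>).
        y \<otimes>\<^bsub>semidirect_product N H \<phi>\<^esub> x = \<one>\<^bsub>semidirect_product N H \<phi>\<^esub>"
      using f k unfolding x
      by (intro bexI[of _ "(\<phi> (inv\<^bsub>H\<^esub> k) (inv\<^bsub>N\<^esub> f), inv\<^bsub>H\<^esub> k)"])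
         (auto simp: semidirect_product_def clo)
  qed (auto simp: semidirect_product_def clo one)
qed

lemma carrier_restricted_wreath_int:
  assumes "group G"
  shows "carrier (restricted_wreath_int G) =
    {f. (\<forall>i. f i \<in> carrier G) \<and> finite {i. f i \<noteq> \<one>\<^bsub>G\<^esub>}} \<times> UNIV"
  using assms
  by (auto simp: restricted_wreath_int_def semidirect_product_def carrier_sum_group PiE_def Pi_def)

lemma one_restricted_wreath_int: "\<one>\<^bsub>restricted_wreath_int G\<^esub> = ((\<lambda>_. \<one>\<^bsub>G\<^esub>), 0)"
  by (simp add: restricted_wreath_int_def semidirect_product_def restrict_UNIV)

lemma mult_restricted_wreath_int:
  "(f, k) \<otimes>\<^bsub>restricted_wreath_int G\<^esub> (g, l) = ((\<lambda>i. f i \<otimes>\<^bsub>G\<^esub> g (i - k)), k + l)"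
  by (simp add: restricted_wreath_int_def semidirect_product_def restrict_UNIV)

lemma finite_shifted_support:
  assumes "finite {i. f i \<noteq> z}"
  shows "finite {i::int. f (i - k) \<noteq> z}"
proof -
  have "{i. f (i - k) \<noteq> z} = (\<lambda>i. i + k) ` {i. f i \<noteq> z}"
    by (auto simp: image_iff intro!: exI[of _ "_ - k"])
  then show ?thesis using assms by simp
qed

lemma group_restricted_wreath_int:
  assumes G: "group G"
  shows "group (restricted_wreath_int G)"
  unfolding restricted_wreath_int_def
proof (rule group_semidirect_product)
  show "(\<lambda>f i. f (i - k)) \<in> hom (sum_group UNIV (\<lambda>_. G)) (sum_group UNIV (\<lambda>_. G))" for k :: int
    using G by (auto simp: hom_def carrier_sum_group finite_shifted_support)
qed (use G in \<open>auto simp: algebra_simps\<close>)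

definition single_lamp :: "('a, 'm) monoid_scheme \<Rightarrow> int \<Rightarrow> 'a \<Rightarrow> int \<Rightarrow> 'a" where
  "single_lamp G j x = (\<lambda>i. if i = j then x else \<one>\<^bsub>G\<^esub>)"

text \<open>The generator with \<open>x = \<one>\<close> is the pure shift. Conjugating by its powers moves the lamp at position
  \<open>1\<close> to any other position, and a finitely supported configuration is a product of single lamps.\<close>

lemma restricted_wreath_int_generated:
  fixes G (structure)
  assumes G: "group G"
  defines "W \<equiv> restricted_wreath_int G"
  shows "generate W ((\<lambda>x. (single_lamp G 1 x, 1)) ` carrier G) = carrier W"
proof -
  interpret G: group G by (rule G)
  interpret W: group W unfolding W_def by (rule group_restricted_wreath_int[OF G])
  let ?S = "(\<lambda>x. (single_lamp G 1 x, 1)) ` carrier G"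
  note carr = carrier_restricted_wreath_int[OF G, folded W_def]
  note one = one_restricted_wreath_int[where G = G, folded W_def]
  note mult = mult_restricted_wreath_int[where G = G, folded W_def]
  have single_one: "single_lamp G j \<one> = (\<lambda>_. \<one>)" for j
    by (auto simp: single_lamp_def)
  have "finite {i. single_lamp G j x i \<noteq> \<one>}" for j x
    by (rule finite_subset[of _ "{j}"]) (auto simp: single_lamp_def)
  then have S: "?S \<subseteq> carrier W"
    by (auto simp: carr) (simp add: single_lamp_def)
  have H: "subgroup (generate W ?S) W"
    by (rule W.generate_is_subgroup[OF S])
  note mem_mult = subgroup.m_closed[OF H]
  have gen: "(single_lamp G 1 x, 1) \<in> generate W ?S" if "x \<in> carrier G" for x
    using that by (auto intro: generate.incl)
  have shift: "((\<lambda>_. \<one>), 1) \<in> generate W ?S"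
    using gen[of \<one>] by (simp add: single_one)
  have "inv\<^bsub>W\<^esub> ((\<lambda>_. \<one>), 1) = ((\<lambda>_. \<one>), -1)"
    by (rule W.inv_equality) (auto simp: carr one mult)
  then have unshift: "((\<lambda>_. \<one>), -1) \<in> generate W ?S"
    using subgroup.m_inv_closed[OF H shift] by simp
  have shifts: "((\<lambda>_. \<one>), k) \<in> generate W ?S" for k
  proof (induction k rule: int_induct[of _ 0])
    case base
    show ?case using subgroup.one_closed[OF H] by (simp add: one)
  next
    case (step1 k)
    show ?case using mem_mult[OF step1(2) shift] by (simp add: mult)
  next
    case (step2 k)
    show ?case using mem_mult[OF step2(2) unshift] by (simp add: mult)
  qed
  have single: "(single_lamp G j x, 0) \<in> generate W ?S" if x: "x \<in> carrier G" for j x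
  proof -
    have "((\<lambda>_. \<one>), j - 1) \<otimes>\<^bsub>W\<^esub> (single_lamp G 1 x, 1) \<otimes>\<^bsub>W\<^esub> ((\<lambda>_. \<one>), -j) = (single_lamp G j x, 0)"
      using x by (auto simp: mult single_lamp_def)
    then show ?thesis
      using mem_mult[OF mem_mult[OF shifts gen[OF x]] shifts] by metis
  qed
  have base: "(f, 0) \<in> generate W ?S"
    if "finite F" "\<And>i. f i \<in> carrier G" "{i. f i \<noteq> \<one>} \<subseteq> F" for f F
    using that
  proof (induction F arbitrary: f rule: finite_induct)
    case empty
    then have "f = (\<lambda>_. \<one>)" by auto
    then show ?case using shifts by simp
  next
    case (insert j F)
    have "(f(j := \<one>), 0) \<in> generate W ?S"
      using insert.prems by (intro insert.IH) auto
    moreover have "(single_lamp G j (f j), 0) \<otimes>\<^bsub>W\<^esub> (f(j := \<one>), 0) = (f, 0)"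
      using insert.prems(1) by (auto simp: mult single_lamp_def)
    ultimately show ?case
      using mem_mult[OF single[OF insert.prems(1)]] by metis
  qed
  have "(f, k) \<in> generate W ?S" if "(f, k) \<in> carrier W" for f k
  proof -
    have f: "\<And>i. f i \<in> carrier G" "finite {i. f i \<noteq> \<one>}"
      using that by (auto simp: carr)
    have "(f, 0) \<otimes>\<^bsub>W\<^esub> ((\<lambda>_. \<one>), k) = (f, k)"
      using f by (simp add: mult)
    then show ?thesis
      using mem_mult[OF base[OF f(2) f(1) order_refl] shifts[of k]] by simp
  qed
  then show ?thesis
    using W.generate_incl[OF S] by auto
qed

section \<open>The automorphism group of the rooted tree\<close>

lemma group_tree_aut: "group (tree_aut X)"
proof (rule groupI)
  fix f g assume fg: "f \<in> carrier (tree_aut X)" "g \<in> carrier (tree_aut X)"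
  then have "f u \<in> lists X" "g u \<in> lists X" if "u \<in> lists X" for u
    using that by (auto simp: tree_aut_def dest!: Bij_imp_funcset)
  then show "f \<otimes>\<^bsub>tree_aut X\<^esub> g \<in> carrier (tree_aut X)"
    using fg by (simp add: tree_aut_def compose_Bij compose_eq)
next
  fix f g h assume "f \<in> carrier (tree_aut X)" "g \<in> carrier (tree_aut X)" "h \<in> carrier (tree_aut X)"
  then show "f \<otimes>\<^bsub>tree_aut X\<^esub> g \<otimes>\<^bsub>tree_aut X\<^esub> h = f \<otimes>\<^bsub>tree_aut X\<^esub> (g \<otimes>\<^bsub>tree_aut X\<^esub> h)"
    by (simp add: tree_aut_def compose_assoc[OF Bij_imp_funcset])
next
  fix f assume "f \<in> carrier (tree_aut X)"
  then have f: "f \<in> Bij (lists X)" "f [] = []"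
    and adj: "\<And>u v. u \<in> lists X \<Longrightarrow> v \<in> lists X \<Longrightarrow> tree_adjacent X (f u) (f v) \<longleftrightarrow> tree_adjacent X u v"
    by (auto simp: tree_aut_def)
  let ?g = "\<lambda>w\<in>lists X. inv_into (lists X) f w"
  have inj: "inj_on f (lists X)" and im: "f ` lists X = lists X"
    using f(1) by (auto simp: Bij_def bij_betw_def)
  have fg: "f (?g w) = w" "?g w \<in> lists X" if "w \<in> lists X" for w
    using that f_inv_into_f[of w f "lists X"] inv_into_into[of w f "lists X"] im by auto
  have "?g [] = []"
    using fg[of "[]"] f(2) inj by (metis inj_onD lists.Nil)
  moreover have "tree_adjacent X (?g u) (?g v) \<longleftrightarrow> tree_adjacent X u v"
    if "u \<in> lists X" "v \<in> lists X" for u v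
    using adj[OF fg(2)[OF that(1)] fg(2)[OF that(2)]] fg(1) that by metis
  ultimately have "?g \<in> carrier (tree_aut X)"
    using restrict_inv_into_Bij[OF f(1)] unfolding tree_aut_def by auto
  moreover have "?g \<otimes>\<^bsub>tree_aut X\<^esub> f = \<one>\<^bsub>tree_aut X\<^esub>"
    using fg by (auto simp: tree_aut_def compose_def restrict_def)
  ultimately show "\<exists>g\<in>carrier (tree_aut X). g \<otimes>\<^bsub>tree_aut X\<^esub> f = \<one>\<^bsub>tree_aut X\<^esub>"
    by (intro bexI[of _ ?g])
next
  fix f assume "f \<in> carrier (tree_aut X)"
  then have "f \<in> Bij (lists X)" by (simp add: tree_aut_def)
  then show "\<one>\<^bsub>tree_aut X\<^esub> \<otimes>\<^bsub>tree_aut X\<^esub> f = f"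
    by (auto simp: tree_aut_def compose_def fun_eq_iff dest: Bij_imp_extensional intro: extensional_arb[symmetric])
qed (simp add: tree_aut_def id_Bij)

text \<open>Extending a word by a letter is the only way to be adjacent, so a map that commutes with such
  extensions up to the choice of the letter preserves adjacency. Applied to the inverse map as well,
  this gives the equivalence that tree automorphisms must satisfy.\<close>

lemma tree_autI:
  assumes f: "f \<in> lists X \<rightarrow>\<^sub>E lists X" and g: "g \<in> lists X \<rightarrow>\<^sub>E lists X"
    and fg: "\<And>w. w \<in> lists X \<Longrightarrow> f (g w) = w" and gf: "\<And>w. w \<in> lists X \<Longrightarrow> g (f w) = w"
    and f0: "f [] = []"
    and f1: "\<And>w x. w \<in> lists X \<Longrightarrow> x \<in> X \<Longrightarrow> \<exists>y\<in>X. f (w @ [x]) = f w @ [y]"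
    and g1: "\<And>w x. w \<in> lists X \<Longrightarrow> x \<in> X \<Longrightarrow> \<exists>y\<in>X. g (w @ [x]) = g w @ [y]"
  shows "f \<in> carrier (tree_aut X)"
proof -
  have "f \<in> Bij (lists X)"
    using f g fg gf unfolding Bij_def PiE_def by (auto intro!: bij_betwI[of f _ _ g])
  moreover have adj: "tree_adjacent X (h u) (h v)"
    if "\<And>w x. w \<in> lists X \<Longrightarrow> x \<in> X \<Longrightarrow> \<exists>y\<in>X. h (w @ [x]) = h w @ [y]"
      "u \<in> lists X" "v \<in> lists X" "tree_adjacent X u v" for h u v
    using that(2-) that(1)[of u] that(1)[of v] unfolding tree_adjacent_def by blast
  moreover have "tree_adjacent X (f u) (f v) \<longleftrightarrow> tree_adjacent X u v"
    if "u \<in> lists X" "v \<in> lists X" for u v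
    using adj[where h = f, OF f1, of u v] adj[where h = g, OF g1, of "f u" "f v"] that f gf by (auto simp: PiE_def Pi_def)
  ultimately show ?thesis
    using f0 by (simp add: tree_aut_def)
qed

section \<open>Power series over the field with two elements\<close>

unbundle fps_syntax

text \<open>Sums and products of bits must not be rewritten to bitwise operations: the ring laws are used below.\<close>

declare add_bit_eq_xor [simp del] mult_bit_eq_and [simp del]

lemma bit_fps_add_self: "x + x = (0 :: bit fps)"
proof (rule fps_ext)
  show "(x + x) $ n = 0 $ n" for n
    by (cases "x $ n") (simp_all only: fps_add_nth fps_zero_nth, simp_all add: one_add_one)
qed

lemma bit_of_int_mod: "(of_int (x mod 2) :: bit) = of_int x"
proof -
  have "(of_int x :: bit) = of_int (2 * (x div 2) + x mod 2)" by simp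
  also have "\<dots> = of_int (x mod 2)"
    by (simp only: of_int_add of_int_mult of_int_numeral bit_2_eq_0 mult_zero_left add_0)
  finally show ?thesis by simp
qed

definition unit_series :: "bit fps" where
  "unit_series = inverse ((1 + fps_X) ^ 2)"

definition alpha :: "bit fps" where
  "alpha = 1 + fps_X * unit_series"

lemma unit_series_mult: "unit_series * (1 + fps_X) ^ 2 = 1"
  unfolding unit_series_def by (rule inverse_mult_eq_1) (simp add: power2_eq_square)

text \<open>This is \<open>u (1 + t)\<^sup>2 = 1\<close> solved for \<open>u\<close>, using \<open>(1 + t)\<^sup>2 = 1 + t\<^sup>2\<close> in characteristic two.\<close>

lemma unit_series_eq: "unit_series = 1 + fps_X * fps_X * unit_series"
proof -
  have "unit_series = unit_series * (1 + fps_X) ^ 2 + fps_X * fps_X * unit_series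
      + (- (fps_X * unit_series + fps_X * unit_series)
         - (fps_X * fps_X * unit_series + fps_X * fps_X * unit_series))"
    by (simp add: power2_eq_square algebra_simps)
  then show ?thesis
    by (simp only: unit_series_mult bit_fps_add_self) simp
qed

lemma alpha_mult: "alpha * (1 + fps_X) ^ 2 = 1 + fps_X + fps_X ^ 2"
proof -
  have "alpha * (1 + fps_X) ^ 2 = (1 + fps_X) ^ 2 + fps_X * (unit_series * (1 + fps_X) ^ 2)"
    by (simp add: alpha_def algebra_simps)
  also have "\<dots> = 1 + fps_X + fps_X ^ 2 + (fps_X + fps_X)"
    by (simp only: unit_series_mult) (simp add: power2_eq_square algebra_simps)
  finally show ?thesis
    by (simp only: bit_fps_add_self) simp
qed

text \<open>Multiply the relation by \<open>B\<^sup>n\<close> with \<open>B = (1 + t)\<^sup>2\<close>. With \<open>A = \<alpha> B = 1 + t + t\<^sup>2\<close> every summand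
  becomes a polynomial, and all but the top one, \<open>(p n + q n t) A\<^sup>n\<close>, keep a factor \<open>B\<close>. So \<open>B\<close>
  divides the top summand. Because \<open>A\<^sup>2 = 1 + t\<^sup>2 B\<close>, the polynomial \<open>A\<close> is invertible modulo \<open>B\<close>, hence
  \<open>B\<close> divides \<open>p n + q n t\<close>, whose degree is too small unless it vanishes.\<close>

lemma alpha_independent_top:
  fixes p q :: "nat \<Rightarrow> bit"
  assumes "(\<Sum>i\<le>n. (fps_const (p i) + fps_const (q i) * fps_X) * alpha ^ i) = 0"
  shows "p n = 0 \<and> q n = 0"
proof -
  define A :: "bit poly" where "A = [:1, 1, 1:]"
  define B :: "bit poly" where "B = [:1, 1:] ^ 2"
  define L where "L = [:p n, q n:]"
  have B_eq: "B = [:1, 0, 1:]"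
    by (simp add: B_def power2_eq_square one_add_one)
  have A_fps: "fps_of_poly A = 1 + fps_X + fps_X ^ 2"
    by (simp add: A_def fps_of_poly_pCons power2_eq_square algebra_simps)
  have B_fps: "fps_of_poly B = (1 + fps_X) ^ 2"
    by (simp add: B_def fps_of_poly_power fps_of_poly_pCons)
  have lin_fps: "fps_of_poly [:p i, q i:] = fps_const (p i) + fps_const (q i) * fps_X" for i
    by (simp add: fps_of_poly_pCons)
  have clear: "fps_of_poly ([:p i, q i:] * A ^ i * B ^ (n - i)) =
      (fps_const (p i) + fps_const (q i) * fps_X) * alpha ^ i * fps_of_poly B ^ n" if "i \<le> n" for i
  proof -
    have "fps_of_poly B ^ n = fps_of_poly B ^ i * fps_of_poly B ^ (n - i)"
      using that by (simp flip: power_add)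
    moreover have "fps_of_poly A ^ i = alpha ^ i * fps_of_poly B ^ i"
      by (simp only: A_fps B_fps alpha_mult[symmetric] power_mult_distrib)
    ultimately show ?thesis
      by (simp only: fps_of_poly_mult fps_of_poly_power lin_fps mult_ac)
  qed
  have "fps_of_poly (\<Sum>i\<le>n. [:p i, q i:] * A ^ i * B ^ (n - i)) =
      (\<Sum>i\<le>n. (fps_const (p i) + fps_const (q i) * fps_X) * alpha ^ i) * fps_of_poly B ^ n"
    unfolding fps_of_poly_sum sum_distrib_right by (rule sum.cong) (simp_all only: clear atMost_iff)
  then have "(\<Sum>i\<le>n. [:p i, q i:] * A ^ i * B ^ (n - i)) = 0"
    by (simp only: assms mult_zero_left fps_of_poly_eq_iff[symmetric] fps_of_poly_0)
  then have "L * A ^ n + (\<Sum>i<n. [:p i, q i:] * A ^ i * B ^ (n - i)) = 0"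
    by (simp only: L_def sum.lessThan_Suc add.commute diff_self_eq_0 power_0 mult_1_right
        flip: lessThan_Suc_atMost)
  then have top: "L * A ^ n = - (\<Sum>i<n. [:p i, q i:] * A ^ i * B ^ (n - i))"
    by (simp only: eq_neg_iff_add_eq_0)
  moreover have "B dvd (\<Sum>i<n. [:p i, q i:] * A ^ i * B ^ (n - i))"
    by (intro dvd_sum dvd_mult dvd_power) auto
  ultimately have "B dvd L * A ^ n"
    by (simp only: top dvd_minus_iff)
  then have "B dvd L * A ^ n * A ^ n"
    by (rule dvd_mult2)
  moreover have "B dvd (A ^ 2) ^ n - 1"
  proof -
    have "A ^ 2 - 1 = B * [:0, 0, 1:]"
      by (simp add: A_def B_eq power2_eq_square one_add_one one_pCons)
    then have "B dvd A ^ 2 - 1" by (simp only: dvd_triv_left)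
    moreover have "A ^ 2 - 1 dvd (A ^ 2) ^ n - 1"
      unfolding power_diff_1_eq[of "A ^ 2" n] by (rule dvd_triv_left)
    ultimately show ?thesis by (rule dvd_trans)
  qed
  then have "B dvd L * ((A ^ 2) ^ n - 1)" by (rule dvd_mult)
  ultimately have "B dvd L * A ^ n * A ^ n - L * ((A ^ 2) ^ n - 1)"
    by (rule dvd_diff)
  also have "L * A ^ n * A ^ n - L * ((A ^ 2) ^ n - 1) = L"
    by (simp only: power2_eq_square power_mult_distrib right_diff_distrib mult.assoc) simp
  finally have "B dvd L" .
  moreover have "degree L < degree B"
    by (simp add: L_def B_eq)
  ultimately have "L = 0"
    using dvd_imp_degree_le by fastforce
  then show ?thesis by (simp add: L_def)
qed

lemma alpha_independent:
  fixes p q :: "nat \<Rightarrow> bit"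
  assumes "(\<Sum>i\<le>n. (fps_const (p i) + fps_const (q i) * fps_X) * alpha ^ i) = 0"
  shows "\<forall>i\<le>n. p i = 0 \<and> q i = 0"
  using assms
proof (induction n)
  case 0
  from alpha_independent_top[OF 0] show ?case by simp
next
  case (Suc n)
  have top: "p (Suc n) = 0 \<and> q (Suc n) = 0"
    by (rule alpha_independent_top[OF Suc.prems])
  have "(\<Sum>i\<le>n. (fps_const (p i) + fps_const (q i) * fps_X) * alpha ^ i) = 0"
    using Suc.prems by (simp only: sum.atMost_Suc top fps_const_0_eq_0 mult_zero_left add_0_right)
  from Suc.IH[OF this] top show ?case
    by (metis le_SucE)
qed

text \<open>Integer powers are defined by hand, as power series do not form a division ring; \<open>\<alpha>\<close> is
  a unit since its constant coefficient is \<open>1\<close>.\<close>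

definition alpha_power :: "int \<Rightarrow> bit fps" where
  "alpha_power k = (if k \<ge> 0 then alpha ^ nat k else inverse alpha ^ nat (- k))"

lemma alpha_inverse: "alpha * inverse alpha = 1"
proof -
  have "alpha $ 0 \<noteq> 0" by (simp add: alpha_def)
  then show ?thesis by (metis inverse_mult_eq_1 mult.commute)
qed

lemma alpha_nonzero: "alpha \<noteq> 0"
  using alpha_inverse by auto

lemma alpha_power_0: "alpha_power 0 = 1"
  by (simp add: alpha_power_def)

lemma alpha_power_1: "alpha_power 1 = alpha"
  by (simp add: alpha_power_def)

lemma alpha_power_of_nat: "alpha_power (int n) = alpha ^ n"
  by (simp add: alpha_power_def)

lemma alpha_power_succ: "alpha_power (k + 1) = alpha_power k * alpha"
proof (cases "k \<ge> 0")
  case True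
  then have "nat (k + 1) = Suc (nat k)" by simp
  with True show ?thesis by (simp add: alpha_power_def)
next
  case False
  then have "nat (- k) = Suc (nat (- (k + 1)))" by simp
  then have "alpha_power k * alpha = inverse alpha ^ nat (- (k + 1)) * (alpha * inverse alpha)"
    using False by (simp add: alpha_power_def mult_ac)
  also have "\<dots> = alpha_power (k + 1)"
    using False by (auto simp: alpha_inverse alpha_power_def)
  finally show ?thesis by simp
qed

lemma alpha_power_add: "alpha_power (k + l) = alpha_power k * alpha_power l"
proof (induction l rule: int_induct[of _ 0])
  case base
  show ?case by (simp add: alpha_power_0)
next
  case (step1 l)
  then show ?case
    using alpha_power_succ[of "k + l"] alpha_power_succ[of l] by (simp add: add.assoc mult.assoc)
next
  case (step2 l)
  have "alpha_power (k + l) = alpha_power (k + (l - 1)) * alpha"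
    using alpha_power_succ[of "k + (l - 1)"] by (simp only: add.assoc diff_add_cancel)
  moreover have "alpha_power l = alpha_power (l - 1) * alpha"
    using alpha_power_succ[of "l - 1"] by (simp only: diff_add_cancel)
  ultimately have "alpha_power (k + (l - 1)) * alpha = alpha_power k * alpha_power (l - 1) * alpha"
    using step2(2) by (simp only: mult.assoc)
  then show ?case
    by (simp only: mult_right_cancel[OF alpha_nonzero])
qed

lemma alpha_power_minus: "alpha_power (- k) * alpha_power k = 1"
  using alpha_power_add[of "- k" k] by (simp only: alpha_power_0 left_minus)

text \<open>The equation \<open>\<alpha>\<^sup>n = 1\<close> with \<open>n > 0\<close> would be the relation \<open>1 + \<alpha>\<^sup>n = 0\<close>.\<close>

lemma alpha_power_eq_1D:
  assumes "alpha_power k = 1"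
  shows "k = 0"
proof (rule ccontr)
  assume "k \<noteq> 0"
  then obtain m where m: "nat \<bar>k\<bar> = Suc m"
    by (metis gr0_implies_Suc zero_less_abs_iff zero_less_nat_eq)
  have "alpha_power (- k) = 1"
    using alpha_power_minus[of k] assms by simp
  then have "alpha_power (int (Suc m)) = 1"
    using assms unfolding m[symmetric] by (cases "k \<ge> 0") simp_all
  then have pow: "alpha ^ Suc m = 1"
    by (simp only: alpha_power_of_nat)
  define p :: "nat \<Rightarrow> bit" where "p i = (if i = 0 \<or> i = Suc m then 1 else 0)" for i
  have "(\<Sum>i\<le>m. (fps_const (p i) + fps_const 0 * fps_X) * alpha ^ i) = (\<Sum>i\<le>m. if i = 0 then 1 else 0)"
    by (rule sum.cong) (auto simp: p_def)
  then have "(\<Sum>i\<le>Suc m. (fps_const (p i) + fps_const 0 * fps_X) * alpha ^ i) = 1 + 1"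
    unfolding sum.atMost_Suc pow by (simp add: p_def)
  then show False
    using alpha_independent_top[of p "\<lambda>_. 0" "Suc m"] by (simp only: bit_fps_add_self) (simp add: p_def)
qed

section \<open>Words as truncated power series\<close>

text \<open>The letter \<open>0\<close> is coded by the coefficient \<open>1\<close> and conversely. This complement turns the word
  consisting of letters \<open>1\<close>, which \<open>c\<close> fixes, into the series \<open>0\<close>, so that \<open>c\<close> acts linearly.\<close>

definition word_series :: "nat list \<Rightarrow> bit fps" where
  "word_series w = Abs_fps (\<lambda>i. if i < length w \<and> w ! i = 0 then 1 else 0)"

definition series_word :: "nat \<Rightarrow> bit fps \<Rightarrow> nat list" where
  "series_word n h = map (\<lambda>i. if h $ i = 0 then 1 else 0) [0..<n]"

lemma length_series_word [simp]: "length (series_word n h) = n"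
  by (simp add: series_word_def)

lemma series_word_in_lists: "series_word n h \<in> lists {0, 1}"
  by (auto simp: series_word_def)

lemma series_word_eq_iff: "series_word n g = series_word n h \<longleftrightarrow> fps_cutoff n g = fps_cutoff n h"
proof -
  have "(if x = 0 then (1::nat) else 0) = (if y = 0 then 1 else 0) \<longleftrightarrow> x = y" for x y :: bit
    by (cases x; cases y) auto
  then show ?thesis
    by (auto simp: series_word_def fps_cutoff_eq_fps_cutoff_iff list_eq_iff_nth_eq)
qed

lemma series_word_word_series:
  assumes "w \<in> lists {0, 1}"
  shows "series_word (length w) (word_series w) = w"
proof (rule nth_equalityI)
  fix i assume "i < length (series_word (length w) (word_series w))"
  then have i: "i < length w" by simp
  then have "w ! i = 0 \<or> w ! i = 1"
    using assms nth_mem[OF i] by blast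
  then show "series_word (length w) (word_series w) ! i = w ! i"
    using i by (auto simp: series_word_def word_series_def)
qed simp

lemma word_series_series_word: "word_series (series_word n h) = fps_cutoff n h"
  by (rule fps_ext) (auto simp: series_word_def word_series_def)

lemma series_word_Suc: "series_word (Suc n) h = series_word n h @ [if h $ n = 0 then 1 else 0]"
  by (simp add: series_word_def)

lemma series_word_Cons:
  "series_word (Suc n) (fps_const y + fps_X * h) = (if y = 0 then 1 else 0) # series_word n h"
  by (auto simp: series_word_def upt_conv_Cons simp flip: map_Suc_upt simp del: upt_Suc)

lemma word_series_Cons:
  "word_series (x # w) = fps_const (if x = 0 then 1 else 0) + fps_X * word_series w"
  by (rule fps_ext) (auto simp: word_series_def nth_Cons' less_Suc_eq_0_disj)

lemma word_series_snoc: "fps_cutoff (length w) (word_series (w @ [x])) = word_series w"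
  by (rule fps_ext) (auto simp: word_series_def nth_append)

text \<open>Affine maps do not increase the precision needed: the first \<open>n\<close> coefficients of the result depend
  only on the first \<open>n\<close> coefficients of the argument. This lets affine maps act on finite words.\<close>

lemma fps_cutoff_affine_cong:
  fixes m g g' h :: "'a :: comm_ring_1 fps"
  assumes "fps_cutoff n g = fps_cutoff n g'"
  shows "fps_cutoff n (m * (g + h)) = fps_cutoff n (m * (g' + h))"
proof -
  have "(m * g) $ k = (m * g') $ k" if "k < n" for k
    using fps_cutoff_right_mult_nth[OF that, of m g] fps_cutoff_right_mult_nth[OF that, of m g'] assms
    by simp
  then show ?thesis
    by (simp add: fps_cutoff_eq_fps_cutoff_iff distrib_left)
qed

lemma fps_cutoff_fps_cutoff: "fps_cutoff n (fps_cutoff n h) = fps_cutoff n h"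
  by (rule fps_ext) simp

text \<open>The translation comes before the linear part, so that under composition the translation of the
  second map is twisted by the inverse of the first linear part, as in the semidirect product.\<close>

definition affine_aut :: "bit fps \<Rightarrow> bit fps \<Rightarrow> nat list \<Rightarrow> nat list" where
  "affine_aut m h = (\<lambda>w\<in>lists {0, 1}. series_word (length w) (m * (word_series w + h)))"

lemma affine_aut_compose:
  assumes "n * m = 1"
  shows "compose (lists {0, 1}) (affine_aut m' h') (affine_aut m h) = affine_aut (m * m') (h + n * h')"
proof
  fix w
  show "compose (lists {0, 1}) (affine_aut m' h') (affine_aut m h) w = affine_aut (m * m') (h + n * h') w"
  proof (cases "w \<in> lists {0, 1}")
    case True
    have "affine_aut m' h' (affine_aut m h w) =
        series_word (length w) (m' * (fps_cutoff (length w) (m * (word_series w + h)) + h'))"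
      using True series_word_in_lists by (simp add: affine_aut_def word_series_series_word)
    also have "\<dots> = series_word (length w) (m' * (m * (word_series w + h) + h'))"
      unfolding series_word_eq_iff by (rule fps_cutoff_affine_cong) (rule fps_cutoff_fps_cutoff)
    also have "m' * (m * (word_series w + h) + h') = m' * (m * (word_series w + h) + n * m * h')"
      using assms by simp
    also have "\<dots> = m * m' * (word_series w + (h + n * h'))"
      by (simp add: algebra_simps)
    finally show ?thesis
      using True by (simp add: compose_def affine_aut_def)
  qed (simp_all add: compose_def affine_aut_def)
qed

lemma affine_aut_id: "affine_aut 1 0 = (\<lambda>w\<in>lists {0, 1}. w)"
  by (rule ext) (simp add: affine_aut_def series_word_word_series)

lemma affine_aut_in_tree_aut:
  assumes "n * m = 1"
  shows "affine_aut m h \<in> carrier (tree_aut {0, 1})"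
proof (rule tree_autI[where g = "affine_aut n (- m * h)"])
  have snoc: "\<exists>y\<in>{0, 1}. affine_aut m h (w @ [x]) = affine_aut m h w @ [y]"
    if "w \<in> lists {0, 1}" "x \<in> {0, 1}" for m h w x
  proof -
    have "series_word (length w) (m * (word_series (w @ [x]) + h)) =
          series_word (length w) (m * (word_series w + h))"
      unfolding series_word_eq_iff
      by (rule fps_cutoff_affine_cong) (metis word_series_snoc fps_cutoff_fps_cutoff)
    then show ?thesis
      using that by (auto simp: affine_aut_def series_word_Suc)
  qed
  show "\<exists>y\<in>{0, 1}. affine_aut m h (w @ [x]) = affine_aut m h w @ [y]"
    "\<exists>y\<in>{0, 1}. affine_aut n (- m * h) (w @ [x]) = affine_aut n (- m * h) w @ [y]"
    if "w \<in> lists {0, 1}" "x \<in> {0, 1}" for w x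
    using snoc[OF that] by auto
  have "m * n = 1" using assms by (simp add: mult.commute)
  then have "h + n * (- m * h) = 0" "- m * h + m * h = 0"
    using assms by (simp_all flip: mult.assoc)
  then have "compose (lists {0, 1}) (affine_aut n (- m * h)) (affine_aut m h) = (\<lambda>w\<in>lists {0, 1}. w)"
    "compose (lists {0, 1}) (affine_aut m h) (affine_aut n (- m * h)) = (\<lambda>w\<in>lists {0, 1}. w)"
    using affine_aut_compose[OF assms, of n "- m * h" h] affine_aut_compose[OF \<open>m * n = 1\<close>, of m h "- m * h"]
    by (simp_all only: assms \<open>m * n = 1\<close> affine_aut_id)
  then show "affine_aut n (- m * h) (affine_aut m h w) = w" "affine_aut m h (affine_aut n (- m * h) w) = w"
    if "w \<in> lists {0, 1}" for w
    using that by (metis compose_eq restrict_apply')+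
  show "affine_aut m h \<in> lists {0, 1} \<rightarrow>\<^sub>E lists {0, 1}"
    "affine_aut n (- m * h) \<in> lists {0, 1} \<rightarrow>\<^sub>E lists {0, 1}"
    using series_word_in_lists by (auto simp: affine_aut_def)
qed (simp add: affine_aut_def series_word_def)

text \<open>If the map is the identity on all finite words then it fixes every power series, coefficient by
  coefficient; evaluating at the series \<open>0\<close> and \<open>1\<close> gives \<open>m h = 0\<close> and \<open>m + m h = 1\<close>.\<close>

lemma affine_aut_eq_idD:
  assumes "affine_aut m h = (\<lambda>w\<in>lists {0, 1}. w)" "m \<noteq> 0"
  shows "m = 1 \<and> h = 0"
proof -
  have eq: "fps_cutoff n (m * (fps_cutoff n g + h)) = fps_cutoff n g" for n g
  proof -
    have "affine_aut m h (series_word n g) = series_word n g"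
      using assms(1) series_word_in_lists by (simp)
    then have "series_word n (m * (fps_cutoff n g + h)) = series_word n g"
      using series_word_in_lists by (simp add: affine_aut_def word_series_series_word)
    then show ?thesis by (simp add: series_word_eq_iff)
  qed
  have coeff: "(m * (g + h)) $ k = g $ k" for g k
  proof -
    have "fps_cutoff (Suc k) (m * (g + h)) = fps_cutoff (Suc k) (m * (fps_cutoff (Suc k) g + h))"
      by (rule fps_cutoff_affine_cong) (simp add: fps_cutoff_fps_cutoff)
    then have "fps_cutoff (Suc k) (m * (g + h)) = fps_cutoff (Suc k) g"
      by (simp add: eq)
    then show ?thesis by (simp add: fps_cutoff_eq_fps_cutoff_iff)
  qed
  have "m * (g + h) = g" for g
    by (rule fps_ext) (rule coeff)
  from this[of 0] this[of 1] show ?thesis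
    using assms(2) by (auto simp: distrib_left)
qed

section \<open>The lamplighter group as a group of affine maps\<close>

abbreviation lamp_group :: "(nat \<Rightarrow> int) monoid" where
  "lamp_group \<equiv> product_group {..<2} (\<lambda>_. integer_mod_group 2)"

definition lamp_series :: "(nat \<Rightarrow> int) \<Rightarrow> bit fps" where
  "lamp_series x = unit_series * (fps_const (of_int (x 0)) + fps_const (of_int (x 1)) * fps_X)"

definition translation :: "(int \<Rightarrow> nat \<Rightarrow> int) \<Rightarrow> bit fps" where
  "translation f = Sum_any (\<lambda>i. lamp_series (f i) * alpha_power (- i))"

lemma group_lamp_group: "group lamp_group"
  by simp

lemma lamp_series_one [simp]: "lamp_series \<one>\<^bsub>lamp_group\<^esub> = 0"
  by (simp add: lamp_series_def)

lemma lamp_series_mult: "lamp_series (x \<otimes>\<^bsub>lamp_group\<^esub> y) = lamp_series x + lamp_series y"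
proof -
  have eq: "(x \<otimes>\<^bsub>lamp_group\<^esub> y) 0 = (x 0 + y 0) mod 2" "(x \<otimes>\<^bsub>lamp_group\<^esub> y) 1 = (x 1 + y 1) mod 2"
    by simp_all
  show ?thesis
    unfolding lamp_series_def eq bit_of_int_mod of_int_add fps_const_add[symmetric]
    by (simp only: distrib_left distrib_right add_ac)
qed

lemma finite_translation_support:
  assumes "finite {i. f i \<noteq> \<one>\<^bsub>lamp_group\<^esub>}"
  shows "finite {i. lamp_series (f i) * alpha_power (- i) \<noteq> 0}"
proof (rule finite_subset[OF _ assms], rule subsetI, rule CollectI, rule notI)
  fix i assume "i \<in> {i. lamp_series (f i) * alpha_power (- i) \<noteq> 0}" and "f i = \<one>\<^bsub>lamp_group\<^esub>"
  then show False
    by (simp only: mem_Collect_eq lamp_series_one mult_zero_left not_True_eq_False simp_thms)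
qed

text \<open>Shifting a configuration by \<open>k\<close> multiplies its series by \<open>\<alpha>\<^bsup>-k\<^esup>\<close>. This twisted additivity is
  exactly what makes \<open>(f, k) \<mapsto> (F \<mapsto> \<alpha>\<^sup>k (F + E f))\<close> multiplicative.\<close>

lemma translation_mult:
  assumes f: "finite {i. f i \<noteq> \<one>\<^bsub>lamp_group\<^esub>}" and g: "finite {i. g i \<noteq> \<one>\<^bsub>lamp_group\<^esub>}"
  shows "translation (\<lambda>i. f i \<otimes>\<^bsub>lamp_group\<^esub> g (i - k)) = translation f + alpha_power (- k) * translation g"
proof -
  have "alpha_power (- k) * translation g =
      Sum_any (\<lambda>i. alpha_power (- k) * (lamp_series (g i) * alpha_power (- i)))"
    unfolding translation_def by (rule Sum_any_right_distrib[OF finite_translation_support[OF g]])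
  also have "\<dots> = Sum_any (\<lambda>i. lamp_series (g (i - k)) * alpha_power (- i))"
  proof (rule sym, rule Sum_any.reindex_cong[where l = "\<lambda>i. i + k"])
    show "bij (\<lambda>i. i + k)"
      by (rule bij_betw_byWitness[where f' = "\<lambda>i. i - k"]) auto
    have "alpha_power (- (i + k)) = alpha_power (- k) * alpha_power (- i)" for i
      by (simp add: algebra_simps flip: alpha_power_add)
    then show "(\<lambda>i. lamp_series (g (i - k)) * alpha_power (- i)) \<circ> (\<lambda>i. i + k) =
        (\<lambda>i. alpha_power (- k) * (lamp_series (g i) * alpha_power (- i)))"
      by (simp add: fun_eq_iff mult_ac)
  qed
  finally have shifted: "alpha_power (- k) * translation g =
      Sum_any (\<lambda>i. lamp_series (g (i - k)) * alpha_power (- i))" .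
  have "translation (\<lambda>i. f i \<otimes>\<^bsub>lamp_group\<^esub> g (i - k)) =
      Sum_any (\<lambda>i. lamp_series (f i) * alpha_power (- i) + lamp_series (g (i - k)) * alpha_power (- i))"
    unfolding translation_def lamp_series_mult distrib_right ..
  also have "\<dots> = translation f + Sum_any (\<lambda>i. lamp_series (g (i - k)) * alpha_power (- i))"
    unfolding translation_def
    by (rule Sum_any.distrib) (rule finite_translation_support f finite_shifted_support g)+
  finally show ?thesis by (simp only: shifted)
qed

text \<open>Clearing the factor \<open>u\<close> and multiplying by a high power of \<open>\<alpha>\<close> turns the series of \<open>f\<close> into a
  combination of \<open>1\<close> and \<open>t\<close> with coefficients polynomial in \<open>\<alpha>\<close>, to which linear independence
  applies.\<close>

lemma translation_eq_0D:
  assumes carr: "\<And>i. f i \<in> carrier lamp_group" and fin: "finite {i. f i \<noteq> \<one>\<^bsub>lamp_group\<^esub>}"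
    and zero: "translation f = 0"
  shows "f i = \<one>\<^bsub>lamp_group\<^esub>"
proof -
  let ?S = "{i. lamp_series (f i) * alpha_power (- i) \<noteq> 0}"
  obtain N :: nat where N: "insert i ?S \<subseteq> {- int N..int N}"
  proof -
    have "finite (insert i ?S)" using finite_translation_support[OF fin] by simp
    then obtain m where m: "abs ` insert i ?S \<subseteq> {..m}"
      unfolding finite_int_iff_bounded_le by blast
    have "insert i ?S \<subseteq> {- int (nat m)..int (nat m)}"
    proof
      fix j assume "j \<in> insert i ?S"
      then have "\<bar>j\<bar> \<le> m" using m by blast
      then show "j \<in> {- int (nat m)..int (nat m)}" by (simp add: abs_le_iff)
    qed
    then show thesis by (rule that)
  qed
  define p :: "nat \<Rightarrow> bit" where "p j = of_int (f (int N - int j) 0)" for j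
  define q :: "nat \<Rightarrow> bit" where "q j = of_int (f (int N - int j) 1)" for j
  let ?L = "\<lambda>j. fps_const (of_int (f j 0)) + fps_const (of_int (f j 1)) * fps_X :: bit fps"
  have pow: "alpha_power (int N) * alpha_power (- j) = alpha ^ nat (int N - j)" if "j \<le> int N" for j
    using that by (simp flip: alpha_power_add alpha_power_of_nat)
  have "0 = (1 + fps_X) ^ 2 * alpha_power (int N) * translation f"
    by (simp add: zero)
  also have "translation f = (\<Sum>j\<in>{- int N..int N}. lamp_series (f j) * alpha_power (- j))"
    unfolding translation_def using N by (intro Sum_any.expand_superset) auto
  also have "(1 + fps_X) ^ 2 * alpha_power (int N) * \<dots> =
      (\<Sum>j\<in>{- int N..int N}. (unit_series * (1 + fps_X) ^ 2) * ?L j * (alpha_power (int N) * alpha_power (- j)))"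
    unfolding sum_distrib_left lamp_series_def by (rule sum.cong) (simp_all only: mult_ac)
  also have "\<dots> = (\<Sum>j\<in>{- int N..int N}. ?L j * alpha ^ nat (int N - j))"
    by (rule sum.cong) (simp_all add: pow unit_series_mult)
  also have "\<dots> = (\<Sum>j\<le>2 * N. (fps_const (p j) + fps_const (q j) * fps_X) * alpha ^ j)"
    unfolding p_def q_def
    by (rule sum.reindex_bij_witness[where i = "\<lambda>j. int N - int j" and j = "\<lambda>j. nat (int N - j)"]) auto
  finally have "\<forall>j\<le>2 * N. p j = 0 \<and> q j = 0"
    by (intro alpha_independent) (rule sym)
  moreover have "nat (int N - i) \<le> 2 * N" "int N - int (nat (int N - i)) = i"
    using N by auto
  ultimately have zeros: "of_int (f i 0) = (0 :: bit)" "of_int (f i 1) = (0 :: bit)"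
    unfolding p_def q_def by metis+
  have "x = 0" if "of_int x = (0 :: bit)" "x \<in> {0..<2}" for x :: int
  proof -
    have "x = 0 \<or> x = 1" using that(2) by auto
    then show ?thesis using that(1) by auto
  qed
  moreover have ext: "f i \<in> (\<Pi>\<^sub>E j\<in>{..<2}. {0..<2})"
    using carr[of i] by (simp add: carrier_integer_mod_group)
  then have "f i 0 \<in> {0..<2}" "f i 1 \<in> {0..<2}"
    by (auto simp: PiE_iff)
  ultimately have "f i 0 = 0" "f i 1 = 0" using zeros by blast+
  then have "f i j = (\<lambda>_\<in>{..<2}. 0) j" for j
    using ext by (cases "j = 0 \<or> j = 1") (auto simp: PiE_iff extensional_def)
  then show ?thesis by (simp add: fun_eq_iff)
qed

definition lamplighter_aut :: "(int \<Rightarrow> nat \<Rightarrow> int) \<times> int \<Rightarrow> nat list \<Rightarrow> nat list" where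
  "lamplighter_aut = (\<lambda>(f, k). affine_aut (alpha_power k) (translation f))"

lemma lamplighter_2_2: "lamplighter 2 2 = restricted_wreath_int lamp_group"
  by (simp add: lamplighter_def)

lemma group_hom_lamplighter_aut: "group_hom (lamplighter 2 2) (tree_aut {0, 1}) lamplighter_aut"
proof -
  have "lamplighter_aut \<in> hom (lamplighter 2 2) (tree_aut {0, 1})"
  proof (rule homI)
    fix x assume "x \<in> carrier (lamplighter 2 2)"
    show "lamplighter_aut x \<in> carrier (tree_aut {0, 1})"
      unfolding lamplighter_aut_def
      by (cases x) (simp only: prod.case, rule affine_aut_in_tree_aut, rule alpha_power_minus)
  next
    fix x y assume x: "x \<in> carrier (lamplighter 2 2)" and y: "y \<in> carrier (lamplighter 2 2)"
    obtain f k g l where xy: "x = (f, k)" "y = (g, l)" by (metis surj_pair)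
    have fin: "finite {i. f i \<noteq> \<one>\<^bsub>lamp_group\<^esub>}" "finite {i. g i \<noteq> \<one>\<^bsub>lamp_group\<^esub>}"
      using x y unfolding xy lamplighter_2_2 carrier_restricted_wreath_int[OF group_lamp_group] by blast+
    show "lamplighter_aut (x \<otimes>\<^bsub>lamplighter 2 2\<^esub> y) =
        lamplighter_aut x \<otimes>\<^bsub>tree_aut {0, 1}\<^esub> lamplighter_aut y"
      unfolding xy lamplighter_2_2 mult_restricted_wreath_int lamplighter_aut_def prod.case
        translation_mult[OF fin] alpha_power_add
      unfolding tree_aut_def monoid.simps
      by (rule affine_aut_compose[OF alpha_power_minus, symmetric])
  qed
  then show ?thesis
    unfolding group_hom_def group_hom_axioms_def lamplighter_2_2
    using group_restricted_wreath_int[OF group_lamp_group] group_tree_aut by blast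
qed

lemma lamplighter_aut_inj: "inj_on lamplighter_aut (carrier (lamplighter 2 2))"
proof -
  interpret group_hom "lamplighter 2 2" "tree_aut {0, 1}" lamplighter_aut
    by (rule group_hom_lamplighter_aut)
  have "x = \<one>\<^bsub>lamplighter 2 2\<^esub>"
    if x: "x \<in> carrier (lamplighter 2 2)" and id: "lamplighter_aut x = \<one>\<^bsub>tree_aut {0, 1}\<^esub>" for x
  proof -
    obtain f k where fk: "x = (f, k)" by (metis surj_pair)
    have f: "\<And>i. f i \<in> carrier lamp_group" "finite {i. f i \<noteq> \<one>\<^bsub>lamp_group\<^esub>}"
      using x unfolding fk lamplighter_2_2 carrier_restricted_wreath_int[OF group_lamp_group] by blast+
    have "affine_aut (alpha_power k) (translation f) = (\<lambda>w\<in>lists {0, 1}. w)"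
      using id by (simp add: fk lamplighter_aut_def tree_aut_def)
    moreover have "alpha_power k \<noteq> 0"
      using alpha_power_minus[of k] by auto
    ultimately have "alpha_power k = 1" "translation f = 0"
      using affine_aut_eq_idD by blast+
    then have "k = 0" "f = (\<lambda>_. \<one>\<^bsub>lamp_group\<^esub>)"
      using alpha_power_eq_1D translation_eq_0D[OF f] by blast+
    then show ?thesis
      by (simp only: fk lamplighter_2_2 one_restricted_wreath_int)
  qed
  then show ?thesis
    by (simp add: inj_on_one_iff)
qed

section \<open>The automaton\<close>

text \<open>The coordinates \<open>(s, r)\<close> of a state, read as an element of the group of lamp values: \<open>s\<close> says
  whether the state flips the letter, and \<open>r\<close> whether its successor on the letter \<open>1\<close> does.\<close>

primrec state_lamp :: "state \<Rightarrow> nat \<Rightarrow> int" where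
  "state_lamp state.a = (\<lambda>i\<in>{..<2}. if i = 0 then 1 else 0)"
| "state_lamp state.b = (\<lambda>i\<in>{..<2}. 1)"
| "state_lamp state.c = (\<lambda>i\<in>{..<2}. 0)"
| "state_lamp state.d = (\<lambda>i\<in>{..<2}. if i = 1 then 1 else 0)"

lemma state_lamp_image: "state_lamp ` states \<A> = carrier lamp_group"
proof
  show "state_lamp ` states \<A> \<subseteq> carrier lamp_group"
    by (auto simp: \<A>_def carrier_integer_mod_group)
  show "carrier lamp_group \<subseteq> state_lamp ` states \<A>"
  proof
    fix x assume "x \<in> carrier lamp_group"
    then have x: "x \<in> (\<Pi>\<^sub>E j\<in>{..<2}. {0..<2})"
      by (simp add: carrier_integer_mod_group)
    have "x 0 \<in> {0..<2}" "x 1 \<in> {0..<2}"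
      using x by (auto simp: PiE_iff)
    then consider "x 0 = 1" "x 1 = 0" | "x 0 = 1" "x 1 = 1" | "x 0 = 0" "x 1 = 0" | "x 0 = 0" "x 1 = 1"
      by fastforce
    then obtain q where q: "x 0 = state_lamp q 0" "x 1 = state_lamp q 1"
    proof cases
      case 1
      then show ?thesis by (intro that[of state.a]) simp_all
    next
      case 2
      then show ?thesis by (intro that[of state.b]) simp_all
    next
      case 3
      then show ?thesis by (intro that[of state.c]) simp_all
    next
      case 4
      then show ?thesis by (intro that[of state.d]) simp_all
    qed
    have "x = state_lamp q"
    proof
      fix j :: nat
      consider "j = 0" | "j = 1" | "j \<ge> 2" by linarith
      then show "x j = state_lamp q j"
        using x q by cases (cases q; auto simp: PiE_iff extensional_def)+
    qed
    moreover have "q \<in> states \<A>"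
      by (cases q) (simp_all add: \<A>_def)
    ultimately show "x \<in> state_lamp ` states \<A>" by blast
  qed
qed

text \<open>The wreath recursion in affine form: the output bit is the constant coefficient \<open>x + s\<close>, and the rest
  of the word is transformed by the affine map of the next state \<open>(r + x, s)\<close>.\<close>

lemma affine_recursion:
  "alpha * (fps_const x + fps_X * F) + unit_series * (fps_const s + fps_const r * fps_X) =
   fps_const (x + s) + fps_X * (alpha * F + unit_series * (fps_const (r + x) + fps_const s * fps_X))"
  (is "?lhs = ?rhs")
proof -
  have u: "unit_series * fps_const s = fps_const s + fps_X * fps_X * unit_series * fps_const s"
    by (subst unit_series_eq) (simp add: algebra_simps)
  have "?lhs = alpha * (fps_const x + fps_X * F) + unit_series * fps_const s
      + unit_series * fps_const r * fps_X"
    by (simp add: algebra_simps)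
  also have "\<dots> = ?rhs"
    unfolding u by (simp add: alpha_def algebra_simps flip: fps_const_add)
  finally show ?thesis .
qed

lemma act_affine:
  assumes "w \<in> lists {0, 1}"
  shows "act \<A> q w = series_word (length w) (alpha * word_series w + lamp_series (state_lamp q))"
  using assms
proof (induction w arbitrary: q)
  case Nil
  then show ?case by (simp add: series_word_def)
next
  case (Cons x w)
  let ?q = "transition \<A> q x"
  define x' :: bit where "x' = (if x = 0 then 1 else 0)"
  define s :: bit where "s = of_int (state_lamp q 0)"
  define r :: bit where "r = of_int (state_lamp q 1)"
  have x: "x = 0 \<or> x = 1" using Cons.hyps by simp
  have next_state: "of_int (state_lamp ?q 0) = r + x'" "of_int (state_lamp ?q 1) = s"
    and letter: "out_letter \<A> q x = (if x' + s = 0 then 1 else 0)"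
    using x unfolding x'_def s_def r_def by (cases q; auto simp: \<A>_def)+
  have "alpha * word_series (x # w) + lamp_series (state_lamp q) =
      fps_const (x' + s) + fps_X * (alpha * word_series w + lamp_series (state_lamp ?q))"
    unfolding word_series_Cons lamp_series_def next_state x'_def[symmetric] s_def[symmetric] r_def[symmetric]
    by (rule affine_recursion)
  then show ?case
    by (simp add: series_word_Cons letter Cons.IH)
qed

text \<open>A lamp at position \<open>1\<close> contributes \<open>\<alpha>\<^bsup>-1\<^esup>\<close> times its series, which the multiplication by \<open>\<alpha>\<close>
  that follows cancels.\<close>

lemma state_aut_eq:
  "state_aut \<A> q = lamplighter_aut (single_lamp lamp_group 1 (state_lamp q), 1)"
proof -
  have "translation (single_lamp lamp_group 1 x) = lamp_series x * alpha_power (- 1)" for x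
  proof -
    have "translation (single_lamp lamp_group 1 x) =
        (\<Sum>i\<in>{1}. lamp_series (single_lamp lamp_group 1 x i) * alpha_power (- i))"
      unfolding translation_def
      by (rule Sum_any.expand_superset) (auto simp: single_lamp_def lamp_series_def)
    then show ?thesis by (simp add: single_lamp_def)
  qed
  moreover have "alpha * alpha_power (- 1) = 1"
    using alpha_power_minus[of 1] by (simp add: alpha_power_1 mult.commute)
  ultimately have "alpha * (h + translation (single_lamp lamp_group 1 x)) = alpha * h + lamp_series x" for h x
    by (simp add: distrib_left mult.left_commute)
  moreover have "alphabet \<A> = {0, 1}"
    by (simp add: \<A>_def)
  ultimately show ?thesis
    unfolding state_aut_def lamplighter_aut_def affine_aut_def prod.case alpha_power_1
    by (simp only:) (rule restrict_ext, rule act_affine)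
qed

lemma automaton_group_iso: "lamplighter_aut \<in> iso (lamplighter 2 2) (automaton_group \<A>)"
proof -
  interpret group_hom "lamplighter 2 2" "tree_aut {0, 1}" lamplighter_aut
    by (rule group_hom_lamplighter_aut)
  let ?S = "(\<lambda>x. (single_lamp lamp_group 1 x, 1 :: int)) ` carrier lamp_group"
  have gen: "generate (lamplighter 2 2) ?S = carrier (lamplighter 2 2)"
    unfolding lamplighter_2_2 by (rule restricted_wreath_int_generated[OF group_lamp_group])
  have "?S \<subseteq> carrier (lamplighter 2 2)"
    unfolding gen[symmetric] by (auto intro: generate.incl)
  then have "lamplighter_aut ` carrier (lamplighter 2 2) = generate (tree_aut {0, 1}) (lamplighter_aut ` ?S)"
    using generate_img gen by simp
  also have "lamplighter_aut ` ?S = state_aut \<A> ` states \<A>"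
    unfolding state_lamp_image[symmetric] image_image by (rule image_cong) (simp_all only: state_aut_eq)
  also have "generate (tree_aut {0, 1}) \<dots> = carrier (automaton_group \<A>)"
    by (simp add: automaton_group_def \<A>_def)
  finally have "lamplighter_aut ` carrier (lamplighter 2 2) = carrier (automaton_group \<A>)" .
  moreover have "lamplighter_aut \<in> hom (lamplighter 2 2) (automaton_group \<A>)"
    using homh calculation by (auto simp: hom_def automaton_group_def \<A>_def)
  ultimately show ?thesis
    using lamplighter_aut_inj by (simp add: iso_def bij_betw_def)
qed

text \<open>Every state acts on letters by an involution, so the output functions of the inverse automaton are those of the
  automaton itself; the remaining conditions are finite checks.\<close>

lemma bireversible_A: "bireversible \<A>"
proof -
  have aut: "automaton \<A>"
    by (auto simp: automaton_def \<A>_def)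
  have inv: "invertible \<A>"
    using aut by (auto simp: invertible_def \<A>_def bij_betw_def inj_on_def transpose_def)
  have rev: "reversible \<A>"
    using aut by (auto simp: reversible_def invertible_def automaton_def dual_automaton_def \<A>_def
        bij_betw_def inj_on_def transpose_def)
  have "inv_into {0, 1} (snd (wreath q)) x = snd (wreath q) x" if "x \<in> {0, 1}" for q x
    using that by (intro inv_into_f_eq) (cases q; auto simp: inj_on_def transpose_def)+
  from this[of 0 state.a] this[of 1 state.a] this[of 0 state.c] this[of 1 state.c]
  have inverse_letters: "inv_into {0, Suc 0} (Transposition.transpose 0 (Suc 0)) 0 = Suc 0"
    "inv_into {0, Suc 0} (Transposition.transpose 0 (Suc 0)) (Suc 0) = 0"
    "inv_into {0, Suc 0} id 0 = 0" "inv_into {0, Suc 0} id (Suc 0) = Suc 0"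
    by simp_all
  have "reversible (inverse_automaton \<A>)"
    by (auto simp: reversible_def invertible_def automaton_def dual_automaton_def inverse_automaton_def
        \<A>_def bij_betw_def inj_on_def inverse_letters)
  with inv rev show ?thesis by (simp add: bireversible_def)
qed

theorem theorem3p11:
  shows "card (states \<A>) = 4 \<and> card (alphabet \<A>) = 2 \<and> bireversible \<A> \<and>
    automaton_group \<A> \<cong> lamplighter 2 2"
proof (intro conjI)
  show "card (states \<A>) = 4" "card (alphabet \<A>) = 2"
    by (simp_all add: \<A>_def)
  show "bireversible \<A>"
    by (rule bireversible_A)
  show "automaton_group \<A> \<cong> lamplighter 2 2"
    using group.iso_sym[OF group_hom.axioms(1)[OF group_hom_lamplighter_aut]] automaton_group_iso
    by (auto simp: is_iso_def)
qed

end
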